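(* Let $n\geq 4$ and let $G$ be an edge-colored complete graph $K_n$ containing no monochromatic triangles. Then one of the following holds: (a) each vertex of $G$ is contained in properly colored (PC) cycles of all lengths from $4$ to $n$ (that is, for every $v\in V(G)$ and every integer $\ell$ with $4\le \ell\le n$ there is a PC cycle of length $\ell$ in $G$ containing $v$); (b) $G$ has a degenerate set $S\neq V(G)$; (c) $G$ is an edge-colored $K_5$ composed of two edge-disjoint monochromatic pentagons (cycles of length $5$).
   Context: An edge-colored graph is a simple undirected graph $G$ together with an arbitrary map $col: E(G)\to\mathbb{N}$ (an edge-coloring, not required to be proper). A subgraph is properly colored (PC) if adjacent edges in it have distinct colors; in particular a cycle is PC if any two consecutive edges of it have distinct colors. A subgraph is monochromatic if all of its edges have the same color. A triangle (pentagon) is a cycle of length $3$ ($5$). Degenerate set: a nonempty set $S\subseteq V(G)$ is a degenerate set of $G$ if there is a function $f:S\to\mathbb{N}$ such that for each edge $e=uv$ of $G$: (i) if $u,v\in S$, then $col(e)=f(u)$ or $col(e)=f(v)$; (ii) if $u\in S$ and $v\in V(G)\setminus S$, then $col(e)=f(u)$. *)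

theory Defs
  imports Main
begin

text \<open>
  Finite simple undirected graphs with an edge-coloring. An edge is a two-element set of
  vertices; the values of \<open>col\<close> outside \<open>edges\<close> are irrelevant.
\<close>

record 'a ec_graph =
  verts :: "'a set"
  edges :: "'a set set"
  col :: "'a set \<Rightarrow> nat"

definition edge_colored_graph :: "'a ec_graph \<Rightarrow> bool" where
  "edge_colored_graph G \<longleftrightarrow>
     finite (verts G) \<and> (\<forall>e\<in>edges G. e \<subseteq> verts G \<and> card e = 2)"

definition edge_colored_complete :: "nat \<Rightarrow> 'a ec_graph \<Rightarrow> bool" where
  "edge_colored_complete n G \<longleftrightarrow>
     edge_colored_graph G \<and> card (verts G) = n \<and>
     (\<forall>u\<in>verts G. \<forall>v\<in>verts G. u \<noteq> v \<longrightarrow> {u, v} \<in> edges G)"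

text \<open>
  A cycle is given by a cyclic enumeration of its vertices, whose number is its length.
\<close>

definition cycle_edges :: "'a list \<Rightarrow> 'a set set" where
  "cycle_edges vs = {{vs ! i, vs ! (Suc i mod length vs)} | i. i < length vs}"

definition is_cycle :: "'a ec_graph \<Rightarrow> 'a list \<Rightarrow> bool" where
  "is_cycle G vs \<longleftrightarrow>
     length vs \<ge> 3 \<and> distinct vs \<and> set vs \<subseteq> verts G \<and> cycle_edges vs \<subseteq> edges G"

text \<open>
  The next two properties of a subgraph depend only on its edge set \<open>F\<close>.
\<close>

definition properly_colored :: "'a ec_graph \<Rightarrow> 'a set set \<Rightarrow> bool" where
  "properly_colored G F \<longleftrightarrow>
     (\<forall>e\<in>F. \<forall>e'\<in>F. e \<noteq> e' \<and> e \<inter> e' \<noteq> {} \<longrightarrow> col G e \<noteq> col G e')"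

definition monochromatic :: "'a ec_graph \<Rightarrow> 'a set set \<Rightarrow> bool" where
  "monochromatic G F \<longleftrightarrow> (\<forall>e\<in>F. \<forall>e'\<in>F. col G e = col G e')"

definition degenerate_set :: "'a ec_graph \<Rightarrow> 'a set \<Rightarrow> bool" where
  "degenerate_set G S \<longleftrightarrow>
     S \<noteq> {} \<and> S \<subseteq> verts G \<and>
     (\<exists>f :: 'a \<Rightarrow> nat. \<forall>u v. {u, v} \<in> edges G \<longrightarrow>
        (u \<in> S \<and> v \<in> S \<longrightarrow> col G {u, v} = f u \<or> col G {u, v} = f v) \<and>
        (u \<in> S \<and> v \<in> verts G - S \<longrightarrow> col G {u, v} = f u))"

definition two_mono_pentagons :: "'a ec_graph \<Rightarrow> bool" where
  "two_mono_pentagons G \<longleftrightarrow>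
     edge_colored_complete 5 G \<and>
     (\<exists>C D. is_cycle G C \<and> length C = 5 \<and> monochromatic G (cycle_edges C) \<and>
            is_cycle G D \<and> length D = 5 \<and> monochromatic G (cycle_edges D) \<and>
            cycle_edges C \<inter> cycle_edges D = {} \<and>
            edges G = cycle_edges C \<union> cycle_edges D)"

end

theory Submission
  imports Defs
begin

text \<open>
  Let \<open>u\<^sub>1 \<dots> u\<^sub>k\<close> be a PC cycle through \<open>v\<close> and suppose that no PC cycle of length \<open>k + 1\<close> contains \<open>v\<close>.
  A vertex \<open>x\<close> off the cycle that cannot be inserted between two consecutive vertices sees the cycle
  in one of three ways: \<open>x u\<^sub>i\<close> always has the color of \<open>u\<^sub>i u\<^sub>i\<^sub>+\<^sub>1\<close>, or always that of \<open>u\<^sub>i\<^sub>-\<^sub>1 u\<^sub>i\<close>, or a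
  constant color absent from the cycle. The vertices of the third kind form a degenerate set, and
  the first two kinds cannot coexist; reversing the cycle, assume the first kind only. Unless the
  cycle itself is degenerate, some chord \<open>u\<^sub>p u\<^sub>q\<close> has neither the color of \<open>u\<^sub>p u\<^sub>p\<^sub>+\<^sub>1\<close> nor that of
  \<open>u\<^sub>q u\<^sub>q\<^sub>+\<^sub>1\<close>. Rerouting along this chord and through \<open>x\<close> gives another PC cycle of length \<open>k\<close>, missing
  \<open>u\<^sub>q\<^sub>-\<^sub>1\<close>; the trichotomy for this cycle shows that \<open>x\<close> is the only vertex off the cycle and that
  \<open>u\<^sub>p\<^sub>-\<^sub>1 u\<^sub>q\<^sub>-\<^sub>1\<close> is again such a chord. Rotating the chord around the cycle forces \<open>q = p + 2\<close>, and by
  symmetry \<open>k = 4\<close>, which is the exceptional \<open>K\<^sub>5\<close>. A PC triangle or 4-cycle to start from exists since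
  otherwise the neighbors of \<open>v\<close> that are alone in their color class (or \<open>v\<close>) form a degenerate set.
\<close>

section \<open>Cycle edges and properly colored walks along lists\<close>

lemma cycle_edges_image: "cycle_edges vs = (\<lambda>i. {vs ! i, vs ! (Suc i mod length vs)}) ` {..<length vs}"
  by (auto simp: cycle_edges_def)

lemma cycle_edges_3: "cycle_edges [x, y, z] = {{x, y}, {y, z}, {z, x}}"
proof -
  have "{..<length [x, y, z]} = {0, 1, 2}" by auto
  then show ?thesis by (simp only: cycle_edges_image) simp
qed

lemma cycle_edges_5: "cycle_edges [p, q, r, s, t] = {{p, q}, {q, r}, {r, s}, {s, t}, {t, p}}"
proof -
  have "{..<length [p, q, r, s, t]} = {0, 1, 2, 3, 4}" by auto
  then show ?thesis by (simp only: cycle_edges_image) simp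
qed

text \<open>The colors \<open>a\<close> and \<open>b\<close> belong to the edges entering and
  leaving the walk. Walks then compose by agreeing on the color at the junction, and a cycle is a
  walk for which both edges are the closing edge.\<close>

fun pc_walk :: "('a \<Rightarrow> 'a \<Rightarrow> nat) \<Rightarrow> nat \<Rightarrow> 'a list \<Rightarrow> nat \<Rightarrow> bool" where
  "pc_walk c a [] b \<longleftrightarrow> False"
| "pc_walk c a [v] b \<longleftrightarrow> a \<noteq> b"
| "pc_walk c a (v # w # xs) b \<longleftrightarrow> a \<noteq> c v w \<and> pc_walk c (c v w) (w # xs) b"

lemma pc_walk_Cons:
  "ys \<noteq> [] \<Longrightarrow> pc_walk c a (x # ys) b \<longleftrightarrow> a \<noteq> c x (hd ys) \<and> pc_walk c (c x (hd ys)) ys b"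
  by (cases ys) auto

lemma pc_walk_append:
  "xs \<noteq> [] \<Longrightarrow> ys \<noteq> [] \<Longrightarrow>
    pc_walk c a (xs @ ys) b \<longleftrightarrow>
      pc_walk c a xs (c (last xs) (hd ys)) \<and> pc_walk c (c (last xs) (hd ys)) ys b"
  by (induction c a xs b rule: pc_walk.induct) (auto simp: pc_walk_Cons)

lemma pc_walk_first: "pc_walk c a xs b \<Longrightarrow> 2 \<le> length xs \<Longrightarrow> a \<noteq> c (xs ! 0) (xs ! 1)"
  by (cases "(c, a, xs, b)" rule: pc_walk.cases) auto

lemma pc_walk_last:
  "pc_walk c a xs b \<Longrightarrow> 2 \<le> length xs \<Longrightarrow> c (xs ! (length xs - 2)) (xs ! (length xs - 1)) \<noteq> b"
proof (induction c a xs b rule: pc_walk.induct)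
  case (3 c a v w xs b)
  then show ?case by (cases xs) auto
qed auto

lemma pc_walk_nth:
  "pc_walk c a xs b \<Longrightarrow> i + 2 < length xs \<Longrightarrow>
    c (xs ! i) (xs ! (i + 1)) \<noteq> c (xs ! (i + 1)) (xs ! (i + 2))"
proof (induction c a xs b arbitrary: i rule: pc_walk.induct)
  case (3 c a v w xs b)
  show ?case
  proof (cases i)
    case 0
    with 3 show ?thesis by (cases xs) auto
  next
    case (Suc j)
    with 3 show ?thesis by auto
  qed
qed auto

lemma pc_walk_upto:
  assumes "\<And>i. c (u i) (u (i + 1)) \<noteq> c (u (i + 1)) (u (i + 2))"
    and "i \<le> j"
    and "i < j \<Longrightarrow> a \<noteq> c (u i) (u (i + 1))"
    and "i < j \<Longrightarrow> b \<noteq> c (u (j - 1)) (u j)"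
    and "i = j \<Longrightarrow> a \<noteq> b"
  shows "pc_walk c a (map u [i..j]) b"
  using assms(2-)
proof (induction "nat (j - i)" arbitrary: i a)
  case 0
  then show ?case by simp
next
  case (Suc n)
  then have less: "i < j" by simp
  have "pc_walk c (c (u i) (u (i + 1))) (map u [i + 1..j]) b"
  proof (rule Suc.hyps(1))
    show "c (u i) (u (i + 1)) \<noteq> c (u (i + 1)) (u (i + 1 + 1))"
      using assms(1)[of i] by (simp add: add.assoc)
    show "b \<noteq> c (u (j - 1)) (u j)" using Suc.prems less by simp
    show "c (u i) (u (i + 1)) \<noteq> b" if "i + 1 = j"
      using Suc.prems(3) less that by auto
  qed (use Suc less in auto)
  then show ?case using less Suc.prems(2) by (simp add: upto_rec1[of i j] upto_rec1[of "i+1" j])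
qed

lemma rev_upto_eq_map: "rev [i..j] = map uminus [-j..-i]" for i j :: int
proof (rule nth_equalityI)
  fix m assume "m < length (rev [i..j])"
  then show "rev [i..j] ! m = map uminus [-j..-i] ! m"
    by (simp add: rev_nth nth_upto)
qed simp

lemma pc_walk_rev_upto:
  assumes sym: "\<And>x y. c x y = c y x"
    and pc: "\<And>i. c (u i) (u (i + 1)) \<noteq> c (u (i + 1)) (u (i + 2))"
    and "i \<le> j"
    and "i < j \<Longrightarrow> a \<noteq> c (u (j - 1)) (u j)"
    and "i < j \<Longrightarrow> b \<noteq> c (u i) (u (i + 1))"
    and "i = j \<Longrightarrow> a \<noteq> b"
  shows "pc_walk c a (map u (rev [i..j])) b"
proof -
  \<comment> \<open>The reversed segment is a forward segment of the reflected sequence.\<close>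
  have "pc_walk c a (map (\<lambda>m. u (- m)) [-j..-i]) b"
  proof (rule pc_walk_upto)
    fix m
    show "c (u (- m)) (u (- (m + 1))) \<noteq> c (u (- (m + 1))) (u (- (m + 2)))"
    proof -
      have "- m - 2 + 1 = - (m + 1)" "- m - 2 + 2 = - m" "- (m + 2) = - m - 2" by auto
      then show ?thesis using pc[of "- m - 2"] by (metis sym)
    qed
  next
    show "a \<noteq> c (u (- (- j))) (u (- (- j + 1)))" if "- j < - i"
      using assms(4) that by (simp add: sym[of "u j" "u (j - 1)"])
    show "b \<noteq> c (u (- (- i - 1))) (u (- (- i)))" if "- j < - i"
      using assms(5) that by (simp add: sym[of "u (1 + i)" "u i"] add.commute)
  qed (use assms(3,6) in auto)
  then show ?thesis by (simp add: rev_upto_eq_map comp_def)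
qed

lemma map_upto_ends [simp]:
  fixes i j :: int
  assumes "i \<le> j"
  shows "hd (map u [i..j]) = u i" "last (map u [i..j]) = u j"
    "hd (rev (map u [i..j])) = u j" "last (rev (map u [i..j])) = u i"
proof -
  have l: "[i..j] = i # [i + 1..j]" and r: "[i..j] = [i..j - 1] @ [j]"
    using assms upto_rec1 upto_rec2 by blast+
  show "hd (map u [i..j]) = u i" "last (rev (map u [i..j])) = u i" by (simp_all add: l)
  show "last (map u [i..j]) = u j" "hd (rev (map u [i..j])) = u j" by (simp_all add: r)
qed

section \<open>Cycles as periodic enumerations in a complete graph without monochromatic
  triangles\<close>

locale no_mono_triangle =
  fixes V :: "'a set" and c :: "'a \<Rightarrow> 'a \<Rightarrow> nat"
  assumes finite_V: "finite V"
    and col_sym: "c x y = c y x"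
    and no_mono: "\<lbrakk>x \<in> V; y \<in> V; z \<in> V; x \<noteq> y; y \<noteq> z; x \<noteq> z\<rbrakk> \<Longrightarrow> \<not> (c x y = c x z \<and> c x y = c y z)"
begin

definition pc_cycle :: "'a list \<Rightarrow> bool" where
  "pc_cycle xs \<longleftrightarrow> 3 \<le> length xs \<and> distinct xs \<and> set xs \<subseteq> V \<and>
     pc_walk c (c (last xs) (hd xs)) xs (c (last xs) (hd xs))"

definition degen :: "'a set \<Rightarrow> bool" where
  "degen S \<longleftrightarrow> S \<noteq> {} \<and> S \<subseteq> V \<and>
     (\<exists>f. \<forall>x\<in>S. \<forall>y\<in>V. x \<noteq> y \<longrightarrow>
        (if y \<in> S then c x y = f x \<or> c x y = f y else c x y = f x))"

text \<open>The cycle is unrolled to a \<open>k\<close>-periodic sequence over the integers: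
  rotating and reversing it become shifting and negating the index, and segments passing the
  starting point need no special treatment.\<close>

definition pc_enum :: "int \<Rightarrow> (int \<Rightarrow> 'a) \<Rightarrow> bool" where
  "pc_enum k u \<longleftrightarrow> 3 \<le> k \<and> (\<forall>i. u i \<in> V) \<and> (\<forall>i j. u i = u j \<longleftrightarrow> k dvd i - j) \<and>
     (\<forall>i. c (u i) (u (i + 1)) \<noteq> c (u (i + 1)) (u (i + 2)))"

lemma pc_cycle_enum:
  assumes "pc_cycle xs"
  shows "pc_enum (int (length xs)) (\<lambda>i. xs ! nat (i mod int (length xs)))"
proof -
  define k where "k = int (length xs)"
  have xs: "3 \<le> length xs" "distinct xs" "set xs \<subseteq> V"
    and w: "pc_walk c (c (last xs) (hd xs)) xs (c (last xs) (hd xs))"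
    using assms by (auto simp: pc_cycle_def)
  have k: "3 \<le> k" using xs k_def by simp
  have lt: "nat (i mod k) < length xs" for i
    using k pos_mod_bound[of k i] pos_mod_sign[of k i] unfolding k_def by linarith
  have "c (xs ! nat (i mod k)) (xs ! nat ((i + 1) mod k))
      \<noteq> c (xs ! nat ((i + 1) mod k)) (xs ! nat ((i + 2) mod k))" for i
  proof -
    define m where "m = i mod k"
    have m: "0 \<le> m" "m < k" using k by (auto simp: m_def)
    have m1: "(i + 1) mod k = (m + 1) mod k" "(i + 2) mod k = (m + 2) mod k"
      by (simp_all add: m_def mod_simps)
    have ends: "hd xs = xs ! 0" "last xs = xs ! (length xs - 1)"
      using xs(1) hd_conv_nth[of xs] last_conv_nth[of xs] by fastforce+
    \<comment> \<open>The common vertex of the two edges is an inner, the last or the first entry of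
      \<open>xs\<close>; the last two cases involve the closing edge.\<close>
    consider "m + 2 < k" | "m = k - 2" | "m = k - 1" using m by linarith
    then show ?thesis
    proof cases
      case 1
      then have "nat (m + 1) = nat m + 1" "nat (m + 2) = nat m + 2" using m by auto
      then show ?thesis using pc_walk_nth[OF w, of "nat m"] 1 m
        by (simp add: m1 flip: m_def) (simp add: k_def)
    next
      case 2
      then have "m + 1 = k - 1" "m + 2 = k" by auto
      then have "(m + 1) mod k = k - 1" "(m + 2) mod k = 0" using k by simp_all
      moreover have "nat m = length xs - 2" "nat (k - 1) = length xs - 1" using 2 by (auto simp: k_def)
      ultimately show ?thesis using pc_walk_last[OF w] xs(1)
        by (simp only: m1 ends flip: m_def) simp
    next
      case 3
      then have "m + 1 = k" "m + 2 = 1 + k" by auto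
      then have "(m + 1) mod k = 0" "(m + 2) mod k = 1" using k by (simp_all only: mod_self mod_add_self2) simp
      moreover have "nat m = length xs - 1" using 3 by (auto simp: k_def)
      ultimately show ?thesis using pc_walk_first[OF w] xs(1)
        by (simp add: m1 ends flip: m_def)
    qed
  qed
  moreover have "xs ! nat (i mod k) = xs ! nat (j mod k) \<longleftrightarrow> k dvd i - j" for i j
    using lt[of i] lt[of j] k xs(2)
    by (simp add: nth_eq_iff_index_eq nat_eq_iff2 mod_eq_dvd_iff dvd_diff_commute[of k j i])
  moreover have "xs ! nat (i mod k) \<in> V" for i using lt[of i] xs(3) by auto
  ultimately show ?thesis using k unfolding pc_enum_def k_def by blast
qed

lemma pc_enum_rev:
  assumes "pc_enum k u"
  shows "pc_enum k (\<lambda>i. u (- i))"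
proof -
  have "c (u (- m)) (u (- (m + 1))) \<noteq> c (u (- (m + 1))) (u (- (m + 2)))" for m
  proof -
    have "- m - 2 + 1 = - (m + 1)" "- m - 2 + 2 = - m" "- (m + 2) = - m - 2" by auto
    then show ?thesis using assms unfolding pc_enum_def by (metis col_sym)
  qed
  moreover have "k dvd - i - - j \<longleftrightarrow> k dvd i - j" for i j
    using dvd_diff_commute[of k j i] by simp
  ultimately show ?thesis using assms unfolding pc_enum_def by simp
qed

lemma pc_enum_period: "pc_enum k u \<Longrightarrow> u (i + k) = u i"
  by (simp add: pc_enum_def)

lemma pc_enum_pc: "pc_enum k u \<Longrightarrow> c (u i) (u (i + 1)) \<noteq> c (u (i + 1)) (u (i + 2))"
  by (simp add: pc_enum_def)

lemma pc_enum_pc':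
  assumes "pc_enum k u"
  shows "c (u (i - 1)) (u i) \<noteq> c (u i) (u (i + 1))"
  using pc_enum_pc[OF assms, of "i - 1"] by (simp add: algebra_simps)

lemma pc_enum_inj:
  assumes "pc_enum k u" "j < i + k"
  shows "inj_on u {i..j}"
proof (rule inj_onI)
  fix a b assume "a \<in> {i..j}" "b \<in> {i..j}" "u a = u b"
  then have "k dvd a - b" "\<bar>a - b\<bar> < k" using assms by (auto simp: pc_enum_def)
  then show "a = b" using zdvd_imp_le[of k "\<bar>a - b\<bar>"] by fastforce
qed

lemma pc_enum_range:
  assumes "pc_enum k u" "j = i + k - 1"
  shows "range u = u ` {i..j}"
proof -
  have "u m \<in> u ` {i..j}" for m
  proof (rule image_eqI)
    have "k > 0" using assms by (simp add: pc_enum_def)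
    then show "i + (m - i) mod k \<in> {i..j}" using assms(2) by simp
    have "k dvd m - (i + (m - i) mod k)"
      by (metis diff_diff_eq dvd_minus_mod)
    then show "u m = u (i + (m - i) mod k)" using assms by (simp add: pc_enum_def)
  qed
  then show ?thesis by auto
qed

lemma pc_enum_neq:
  assumes "pc_enum k u" "i < j" "j < i + k"
  shows "u i \<noteq> u j"
  using inj_onD[OF pc_enum_inj[OF assms(1,3)], of i j] assms(2) by auto

lemma pc_enum_in_V: "pc_enum k u \<Longrightarrow> u i \<in> V"
  by (simp add: pc_enum_def)

text \<open>Steps only go upwards, but every \<open>j\<close> has a translate by a multiple of
  \<open>k\<close> above \<open>i\<close>, and periodicity brings the property back down to
  \<open>j\<close>.\<close>

lemma periodic_propagate:
  fixes k :: int
  assumes "P i" and step: "\<And>j. P j \<Longrightarrow> P (j + 1)" and per: "\<And>j. P (j + k) = P j" and "0 < k"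
  shows "P j"
proof -
  have up: "P (i + int m)" for m
  proof (induction m)
    case (Suc m)
    then show ?case using step[of "i + int m"] by (simp add: algebra_simps)
  qed (use \<open>P i\<close> in simp)
  have shift: "P (j + int m * k) = P j" for m
  proof (induction m)
    case (Suc m)
    then show ?case using per[of "j + int m * k"] by (simp add: algebra_simps)
  qed simp
  define m where "m = nat \<bar>i - j\<bar>"
  have "int m \<le> int m * k" using \<open>0 < k\<close> by (simp add: mult_le_cancel_left1)
  then have "i \<le> j + int m * k" unfolding m_def by linarith
  then show ?thesis using up[of "nat (j + int m * k - i)"] shift by simp
qed

text \<open>The \<open>k - 1\<close> indices after \<open>m\<close> cover the whole cycle except
  \<open>u m\<close>. This shows that \<open>v\<close> survives when another vertex is
  dropped.\<close>

lemma pc_enum_range_butone: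
  assumes "pc_enum k u" "v \<in> range u" "v \<noteq> u m" "j = m + k - 1"
  shows "v \<in> u ` {m + 1..j}"
proof -
  have "3 \<le> k" using assms by (simp add: pc_enum_def)
  then have "{m..m + k - 1} = insert m {m + 1..j}" using assms(4) by auto
  then show ?thesis using pc_enum_range[OF assms(1), of "m + k - 1" m] assms(2,3) by auto
qed

section \<open>The three types of vertices off the cycle\<close>

definition fwd :: "(int \<Rightarrow> 'a) \<Rightarrow> 'a \<Rightarrow> bool" where
  "fwd u x \<longleftrightarrow> (\<forall>i. c x (u i) = c (u i) (u (i + 1)))"

definition bwd :: "(int \<Rightarrow> 'a) \<Rightarrow> 'a \<Rightarrow> bool" where
  "bwd u x \<longleftrightarrow> (\<forall>i. c x (u i) = c (u (i - 1)) (u i))"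

definition const :: "(int \<Rightarrow> 'a) \<Rightarrow> 'a \<Rightarrow> nat \<Rightarrow> bool" where
  "const u x a \<longleftrightarrow> (\<forall>i. c x (u i) = a \<and> c (u i) (u (i + 1)) \<noteq> a)"

lemma fwd_rev: "fwd (\<lambda>i. u (- i)) x \<longleftrightarrow> bwd u x"
proof -
  have "fwd (\<lambda>i. u (- i)) x \<longleftrightarrow> (\<forall>i. c x (u (- i)) = c (u (- i - 1)) (u (- i)))"
    by (simp add: fwd_def col_sym[of "u (- i - 1)" for i])
  also have "\<dots> \<longleftrightarrow> bwd u x"
    unfolding bwd_def by (metis minus_minus)
  finally show ?thesis .
qed

text \<open>If inserting \<open>x\<close> next to \<open>u i\<close> fails, the clash is at
  \<open>u i\<close>, at \<open>u (i + 1)\<close> or at \<open>x\<close>. Forward type at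
  \<open>u i\<close> excludes the first clash because the cycle is PC and the last because it would
  give a monochromatic triangle, so forward type passes on to \<open>u (i + 1)\<close>; backward
  type travels the other way. If neither type occurs anywhere, all clashes are at \<open>x\<close>,
  which makes its colors constant.\<close>

lemma off_cycle_cases:
  assumes u: "pc_enum k u" and x: "x \<in> V" "x \<notin> range u"
    and stuck: "\<And>i. \<not> pc_cycle (x # map u [i + 1..i + k])"
  obtains (fwd) "fwd u x" | (bwd) "bwd u x" | (const) a where "const u x a"
proof -
  have k: "3 \<le> k" using u by (simp add: pc_enum_def)
  have pc: "c (u (i - 1)) (u i) \<noteq> c (u i) (u (i + 1))" for i by (rule pc_enum_pc'[OF u])
  \<comment> \<open>Since \<open>u (i + k) = u i\<close>, the list puts \<open>x\<close> between
    \<open>u i\<close> and \<open>u (i + 1)\<close>.\<close>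
  have fail: "c x (u i) = c (u (i - 1)) (u i) \<or> c x (u (i + 1)) = c (u (i + 1)) (u (i + 2))
      \<or> c x (u i) = c x (u (i + 1))" for i
  proof (rule ccontr)
    assume *: "\<not> ?thesis"
    have "pc_walk c (c x (u (i + 1))) (map u [i + 1..i + k]) (c x (u i))"
    proof (rule pc_walk_upto)
      show "c x (u i) \<noteq> c (u (i + k - 1)) (u (i + k))"
        using * pc_enum_period[OF u, of i] pc_enum_period[OF u, of "i - 1"] by (simp add: algebra_simps)
      show "c x (u (i + 1)) \<noteq> c (u (i + 1)) (u (i + 1 + 1))" using * by (simp add: add.assoc)
    qed (use * k pc_enum_pc[OF u] in auto)
    moreover have "last (map u [i + 1..i + k]) = u i" "hd (map u [i + 1..i + k]) = u (i + 1)"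
      "map u [i + 1..i + k] \<noteq> []"
      using k pc_enum_period[OF u, of i] by auto
    moreover have "distinct (map u [i + 1..i + k])"
      using pc_enum_inj[OF u, of "i + k" "i + 1"] by (simp add: distinct_map)
    ultimately have "pc_cycle (x # map u [i + 1..i + k])"
      unfolding pc_cycle_def using x * k pc_enum_in_V[OF u]
      by (auto simp: pc_walk_Cons col_sym[of "u i" x])
    then show False using stuck by blast
  qed
  have tri: "\<not> (c x (u i) = c (u i) (u (i + 1)) \<and> c x (u i) = c x (u (i + 1)))" for i
  proof -
    have "x \<noteq> u i" "x \<noteq> u (i + 1)" "u i \<noteq> u (i + 1)" using x pc_enum_neq[OF u, of i "i + 1"] k by auto
    then show ?thesis using no_mono[of x "u i" "u (i + 1)"] x pc_enum_in_V[OF u] by auto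
  qed
  have per: "u (j + k + 1) = u (j + 1)" "u (j + k - 1) = u (j - 1)" "u (j + k) = u j" for j
    using pc_enum_period[OF u, of j] pc_enum_period[OF u, of "j + 1"] pc_enum_period[OF u, of "j - 1"]
    by (simp_all add: algebra_simps)
  consider i where "c x (u i) = c (u i) (u (i + 1))" | i where "c x (u i) = c (u (i - 1)) (u i)"
    | "\<And>i. c x (u i) \<noteq> c (u i) (u (i + 1)) \<and> c x (u i) \<noteq> c (u (i - 1)) (u i)"
    by blast
  then show ?thesis
  proof cases
    case (1 i)
    have "c x (u j) = c (u j) (u (j + 1))" for j
    proof (rule periodic_propagate[of "\<lambda>j. c x (u j) = c (u j) (u (j + 1))" i k])
      fix j assume "c x (u j) = c (u j) (u (j + 1))"
      then show "c x (u (j + 1)) = c (u (j + 1)) (u (j + 1 + 1))"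
        using fail[of j] tri[of j] pc[of j] by (auto simp: add.assoc)
    qed (use 1 k per in auto)
    then show ?thesis using fwd by (auto simp: fwd_def)
  next
    case (2 i)
    \<comment> \<open>Negated indices turn the upward propagation into one running backwards along
      the cycle.\<close>
    have "c x (u (- j)) = c (u (- j - 1)) (u (- j))" for j
    proof (rule periodic_propagate[of "\<lambda>j. c x (u (- j)) = c (u (- j - 1)) (u (- j))" "- i" k])
      fix j assume *: "c x (u (- j)) = c (u (- j - 1)) (u (- j))"
      have **: "- (j + 1) + 1 = - j" "- (j + 1) + 2 = - j + 1" by auto
      have "\<not> (c x (u (- (j + 1))) = c x (u (- j)))"
        using * tri[of "- j - 1"] by simp
      then show "c x (u (- (j + 1))) = c (u (- (j + 1) - 1)) (u (- (j + 1)))"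
        using fail[of "- (j + 1)"] * pc[of "- j"] unfolding ** by auto
    next
      fix j
      have "u (- (j + k)) = u (- j)" "u (- (j + k) - 1) = u (- j - 1)"
        using per(3)[of "- j - k"] per(3)[of "- j - k - 1"] by simp_all
      then show "(c x (u (- (j + k))) = c (u (- (j + k) - 1)) (u (- (j + k)))) =
          (c x (u (- j)) = c (u (- j - 1)) (u (- j)))" by simp
    qed (use 2 k in auto)
    then have "c x (u j) = c (u (j - 1)) (u j)" for j by (metis minus_minus)
    then show ?thesis using bwd by (auto simp: bwd_def)
  next
    case 3
    have step: "c x (u (j + 1)) = c x (u j)" for j
      using fail[of j] 3[of j] 3[of "j + 1"] by (auto simp: add.assoc)
    have "c x (u j) = c x (u 0)" for j
      by (rule periodic_propagate[of "\<lambda>j. c x (u j) = c x (u 0)" 0 k]) (use step per k in auto)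
    then show ?thesis using 3 const[of "c x (u 0)"] unfolding const_def by metis
  qed
qed

section \<open>Cycles that cannot be lengthened, and how the three types interact\<close>

definition stuck :: "int \<Rightarrow> (int \<Rightarrow> 'a) \<Rightarrow> 'a \<Rightarrow> bool" where
  "stuck k u v \<longleftrightarrow> pc_enum k u \<and> v \<in> range u \<and>
     (\<forall>xs. pc_cycle xs \<longrightarrow> v \<in> set xs \<longrightarrow> int (length xs) \<noteq> k + 1)"

lemma stuckD: "stuck k u v \<Longrightarrow> pc_cycle xs \<Longrightarrow> v \<in> set xs \<Longrightarrow> int (length xs) = k + 1 \<Longrightarrow> False"
  by (simp add: stuck_def)

lemma stuck_rev:
  assumes "stuck k u v"
  shows "stuck k (\<lambda>i. u (- i)) v"
proof -
  have "u i \<in> range (\<lambda>i. u (- i))" for i using rangeI[of "\<lambda>i. u (- i)" "- i"] by simp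
  then have "range (\<lambda>i. u (- i)) = range u" by blast
  then show ?thesis using assms pc_enum_rev by (auto simp: stuck_def)
qed

text \<open>The vertex \<open>u (i + 1)\<close> is exchanged for the pair \<open>x\<close>,
  \<open>y\<close>, which lengthens the cycle by one and keeps \<open>v\<close>. The color
  conditions \<open>cols\<close> are those at the four vertices \<open>u i\<close>,
  \<open>x\<close>, \<open>y\<close>, \<open>u (i + 2)\<close>.\<close>

lemma stuck_replace_by_two:
  assumes st: "stuck k u v" and x: "x \<in> V" "x \<notin> range u" and y: "y \<in> V" "y \<notin> range u" "x \<noteq> y"
    and v: "v \<noteq> u (i + 1)"
    and cols: "c x y \<noteq> c x (u i)" "c x y \<noteq> c y (u (i + 2))"
      "c x (u i) \<noteq> c (u (i - 1)) (u i)" "c y (u (i + 2)) \<noteq> c (u (i + 2)) (u (i + 3))"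
  shows False
proof -
  have u: "pc_enum k u" and k: "3 \<le> k" using st by (auto simp: stuck_def pc_enum_def)
  have per: "u (i + k) = u i" "u (i + k - 1) = u (i - 1)"
    using pc_enum_period[OF u, of i] pc_enum_period[OF u, of "i - 1"] by (simp_all add: algebra_simps)
  let ?ys = "map u [i + 2..i + k]"
  have "pc_walk c (c y (u (i + 2))) ?ys (c x (u i))"
  proof (rule pc_walk_upto)
    show "c y (u (i + 2)) \<noteq> c (u (i + 2)) (u (i + 2 + 1))" using cols by (simp add: add.assoc)
  qed (use cols k per pc_enum_pc[OF u] in auto)
  moreover have "distinct ?ys" using pc_enum_inj[OF u, of "i + k" "i + 2"] by (simp add: distinct_map)
  ultimately have "pc_cycle (x # y # ?ys)"
    unfolding pc_cycle_def using x y k cols pc_enum_in_V[OF u] per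
    by (auto simp: pc_walk_Cons col_sym[of "u i" x])
  moreover have "v \<in> set ?ys"
    using pc_enum_range_butone[OF u _ v, of "i + k"] st by (simp add: stuck_def add.assoc)
  ultimately show False using stuckD[OF st] k by fastforce
qed

lemma stuck_avoid:
  assumes "stuck k u v"
  obtains i where "v \<noteq> u i" "v \<noteq> u (i + 1)"
proof -
  obtain m where "v = u m" using assms by (auto simp: stuck_def)
  then show ?thesis using that[of "m + 1"] assms pc_enum_neq[of k u m "m + 1"] pc_enum_neq[of k u m "m + 1 + 1"]
    by (auto simp: stuck_def pc_enum_def)
qed

text \<open>A detour through \<open>x\<close>, \<open>u i\<close>, \<open>y\<close> that drops one
  neighbor of \<open>u i\<close> lengthens the cycle, unless the edge colors alternate all around.
  In that case a chord of span two yields a longer cycle.\<close>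

lemma stuck_not_fwd_bwd:
  assumes st: "stuck k u v" and x: "x \<in> V" "x \<notin> range u" "fwd u x" and y: "y \<in> V" "y \<notin> range u" "bwd u y"
  shows False
proof -
  define f where "f i = c (u i) (u (i + 1))" for i
  have u: "pc_enum k u" and k: "3 \<le> k" using st by (auto simp: stuck_def pc_enum_def)
  have per: "u (i + k) = u i" for i by (rule pc_enum_period[OF u])
  have f_per: "f (i + k) = f i" for i
    using per[of i] per[of "i + 1"] by (simp add: f_def algebra_simps)
  have f_step: "f i \<noteq> f (i + 1)" for i
    using pc_enum_pc[OF u, of i] by (simp add: f_def add.assoc)
  have f_step': "f (i - 1) \<noteq> f i" for i using f_step[of "i - 1"] by simp
  have fx: "c x (u i) = f i" for i using x by (simp add: fwd_def f_def)
  have fy: "c y (u i) = f (i - 1)" for i using y by (simp add: bwd_def f_def)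
  have xy: "x \<noteq> y" using fx fy f_step' by metis
  have fy1: "c y (u (i + 1)) = f i" and fy2: "c y (u (i + 2)) = f (i + 1)"
    and fy4: "c y (u (i + 4)) = f (i + 3)" for i
    using fy[of "i + 1"] fy[of "i + 2"] fy[of "i + 4"] by (simp_all add: algebra_simps)
  have pcw: "pc_walk c a (map u [i..j]) b"
    if "i \<le> j" "i < j \<Longrightarrow> a \<noteq> f i" "i < j \<Longrightarrow> b \<noteq> f (j - 1)" "i = j \<Longrightarrow> a \<noteq> b" for a i j b
    by (rule pc_walk_upto) (use that pc_enum_pc[OF u] in \<open>auto simp: f_def\<close>)
  have dist: "distinct (map u [i..j])" if "j < i + k" for i j
    using pc_enum_inj[OF u that] by (simp add: distinct_map)
  have notin: "u i \<notin> u ` {a..b}" if "i < a" "b < i + k" for i a b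
    using inj_onD[OF pc_enum_inj[OF u that(2), of], of i] that by force
  have notin': "u i \<notin> u ` {a..b}" if "b < i" "i < a + k" for i a b
    using notin[of "i - k" a b] that per[of "i - k"] by simp
  have V: "u i \<in> V" for i by (rule pc_enum_in_V[OF u])
  \<comment> \<open>Along \<open>u (i - 1)\<close>, \<open>x\<close>, \<open>u i\<close>,
    \<open>y\<close>, \<open>u (i + 2)\<close> the colors are \<open>f (i - 1)\<close>,
    \<open>f i\<close>, \<open>f (i - 1)\<close>, \<open>f (i + 1)\<close>. A clash is possible only
    at \<open>y\<close>; the vertex dropped is \<open>u (i + 1)\<close>.\<close>
  have A: "f (i - 1) = f (i + 1)" if "v \<noteq> u (i + 1)" for i
  proof (rule ccontr)
    assume ne: "f (i - 1) \<noteq> f (i + 1)"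
    let ?ys = "map u [i + 2..i + k - 1]"
    have ends: "u (i + k - 1) = u (i - 1)" using per[of "i - 1"] by (simp add: algebra_simps)
    have "pc_walk c (f (i + 1)) ?ys (f (i - 1))"
    proof (rule pcw)
      show "f (i - 1) \<noteq> f (i + k - 1 - 1)" using f_per[of "i - 2"] f_step'[of "i - 1"] by (simp add: algebra_simps)
      show "f (i + 1) \<noteq> f (i + 2)" using f_step[of "i + 1"] by (simp add: add.assoc)
    qed (use ne k in auto)
    then have "pc_cycle (x # u i # y # ?ys)"
      unfolding pc_cycle_def using x y xy k dist[of "i + k - 1" "i + 2"] V ends f_step'[of i] ne
        notin[of i "i + 2" "i + k - 1"]
      by (auto simp: pc_walk_Cons fx fy[of i] fy2 col_sym[of _ x] col_sym[of _ y])
    moreover have "v \<in> set (u i # ?ys)"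
    proof -
      have "{i + 2..i + k} = insert (i + k) {i + 2..i + k - 1}" using k by auto
      then show ?thesis
        using pc_enum_range_butone[OF u _ that, of "i + k"] st per[of i] by (auto simp: stuck_def add.assoc)
    qed
    ultimately show False using stuckD[OF st] k by fastforce
  qed
  \<comment> \<open>Along \<open>u (i - 2)\<close>, \<open>x\<close>, \<open>u i\<close>,
    \<open>y\<close>, \<open>u (i + 1)\<close> the colors are \<open>f (i - 2)\<close>,
    \<open>f i\<close>, \<open>f (i - 1)\<close>, \<open>f i\<close>. A clash is possible only at
    \<open>x\<close>; the vertex dropped is \<open>u (i - 1)\<close>.\<close>
  have B: "f (i - 2) = f i" if "v \<noteq> u (i - 1)" for i
  proof (rule ccontr)
    assume ne: "f (i - 2) \<noteq> f i"
    let ?ys = "map u [i + 1..i + k - 2]"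
    have ends: "u (i + k - 2) = u (i - 2)" using per[of "i - 2"] by (simp add: algebra_simps)
    have "pc_walk c (f i) ?ys (f (i - 2))"
    proof (rule pcw)
      show "f (i - 2) \<noteq> f (i + k - 2 - 1)" using f_per[of "i - 3"] f_step'[of "i - 2"] by (simp add: algebra_simps)
    qed (use ne k f_step in auto)
    then have "pc_cycle (x # u i # y # ?ys)"
      unfolding pc_cycle_def using x y xy k dist[of "i + k - 2" "i + 1"] V ends f_step'[of i] ne
        notin[of i "i + 1" "i + k - 2"]
      by (auto simp: pc_walk_Cons fx fy[of i] fy1 col_sym[of _ x] col_sym[of _ y])
    moreover have "v \<in> set (u i # ?ys)"
    proof -
      have "{i - 1 + 1..i + k - 2} = insert i {i + 1..i + k - 2}" using k by auto
      then show ?thesis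
        using pc_enum_range_butone[OF u _ that, of "i + k - 2"] st by (auto simp: stuck_def)
    qed
    ultimately show False using stuckD[OF st] k by fastforce
  qed
  \<comment> \<open>The same equation follows from \<open>A\<close> by dropping
    \<open>u (i + 2)\<close> and from \<open>B\<close> by dropping \<open>u (i + 1)\<close>, and
    \<open>v\<close> is at most one of these.\<close>
  have f2: "f (i + 2) = f i" for i
  proof (cases "v = u (i + 2)")
    case True
    then have "v \<noteq> u (i + 2 - 1)" using pc_enum_neq[OF u, of "1 + i" "i + 2"] k by auto
    then show ?thesis using B[of "i + 2"] by simp
  next
    case False
    then show ?thesis using A[of "i + 1"] by (simp add: add.assoc)
  qed
  have f2m: "f (i + 2 * int m) = f i" for i m
  proof (induction m)
    case (Suc m)
    then show ?case using f2[of "i + 2 * int m"] by (simp add: algebra_simps)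
  qed simp
  have "even k"
  proof (rule ccontr)
    assume "odd k"
    then obtain m where m: "k = 2 * m + 1" by (elim oddE)
    then have "f (0 + 2 * int (nat m) + 1) = f 0" using f_per[of 0] k by simp
    then show False using f2m[of 1 "nat m"] f_step[of 0] by (simp add: algebra_simps)
  qed
  with k have k4: "4 \<le> k" by presburger
  obtain i where i: "v \<noteq> u (i + 1)" using stuck_avoid[OF st] by metis
  let ?ys = "map u [i + 4..i + k]"
  have f_vals: "f (i + 2) = f i" "f (i + 3) = f (i + 1)" "f (i + 4) = f i" "f (i - 1) = f (i + 1)"
  proof -
    have "i + 3 = i + 1 + 2" "i + 4 = i + 2 + 2" "i + 1 = i - 1 + 2" by auto
    then show "f (i + 2) = f i" "f (i + 3) = f (i + 1)" "f (i + 4) = f i" "f (i - 1) = f (i + 1)"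
      using f2 by metis+
  qed
  have off: "x \<noteq> u j" "y \<noteq> u j" for j using x y by auto
  have "u i \<noteq> u (i + 2)" by (rule pc_enum_neq[OF u]) (use k in auto)
  \<comment> \<open>By alternation \<open>x\<close> sees both ends of the chord in color
    \<open>f i\<close>, and \<open>y\<close> sees both in color \<open>f (i + 1)\<close>.\<close>
  then have chord: "c (u i) (u (i + 2)) \<noteq> f i" "c (u i) (u (i + 2)) \<noteq> f (i + 1)"
    using no_mono[of x "u i" "u (i + 2)"] no_mono[of y "u i" "u (i + 2)"] off x(1) y(1) V
      fx[of i] fx[of "i + 2"] fy[of i] fy[of "i + 2"] f_vals by (auto simp: algebra_simps)
  have "pc_walk c (f (i + 1)) ?ys (c (u i) (u (i + 2)))"
  proof (rule pcw)
    show "c (u i) (u (i + 2)) \<noteq> f (i + k - 1)"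
      using chord(2) f_vals(4) f_per[of "i - 1"] by (simp add: algebra_simps)
  qed (use chord f_vals f_step[of i] k4 in auto)
  moreover have "distinct ?ys" "u (i + 2) \<notin> set ?ys" "u (i + 3) \<notin> set ?ys" "u (i + 2) \<noteq> u (i + 3)"
    using dist notin[of "i + 2" "i + 4" "i + k"] notin[of "i + 3" "i + 4" "i + k"]
      pc_enum_neq[OF u, of "i + 2" "i + 3"] k by auto
  moreover have "c (u (i + 3)) y = f i" using fy[of "i + 3"] f_vals col_sym[of y "u (i + 3)"] by (simp add: algebra_simps)
  \<comment> \<open>This cycle ends with \<open>u i\<close>, \<open>u (i + 2)\<close> and returns to
    \<open>x\<close>; it drops only \<open>u (i + 1)\<close>. Apart from the chord, its edges
    alternate between \<open>f i\<close> and \<open>f (i + 1)\<close>.\<close>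
  ultimately have "pc_cycle (x # u (i + 3) # y # ?ys @ [u (i + 2)])"
    unfolding pc_cycle_def using x y xy k4 V chord per[of i] f_vals f_step[of i]
    by (auto simp: pc_walk_Cons pc_walk_append fx fy4 col_sym[of _ x])
  moreover have "v \<in> set (u (i + 3) # ?ys @ [u (i + 2)])"
  proof -
    have "{i + 1 + 1..i + k} = {i + 4..i + k} \<union> {i + 3, i + 2}" using k4 by auto
    then show ?thesis
      using pc_enum_range_butone[OF u _ i, of "i + k"] st by (auto simp: stuck_def)
  qed
  ultimately show False using stuckD[OF st] k4 by fastforce
qed

text \<open>If \<open>x y\<close> avoided both constants, the pair could replace a vertex of the
  cycle. If the constants were equal, \<open>x\<close>, \<open>y\<close> and any vertex of the cycle
  would form a monochromatic triangle.\<close>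

lemma stuck_const_same:
  assumes st: "stuck k u v" and x: "x \<in> V" "x \<notin> range u" "const u x a"
    and y: "y \<in> V" "y \<notin> range u" "const u y b" and "x \<noteq> y"
  shows "a \<noteq> b" "c x y = a \<or> c x y = b"
proof -
  obtain i where i: "v \<noteq> u (i + 1)" using stuck_avoid[OF st] by metis
  note two = stuck_replace_by_two[OF st x(1,2) y(1,2) \<open>x \<noteq> y\<close> i]
  have a: "c x (u j) = a" "c (u j) (u (j + 1)) \<noteq> a" "c (u (j - 1)) (u j) \<noteq> a" for j
    using x(3) unfolding const_def by (auto dest: spec[of _ "j - 1"])
  have b: "c y (u j) = b" "c (u j) (u (j + 1)) \<noteq> b" for j
    using y(3) unfolding const_def by auto
  have b': "c (u (i + 2)) (u (i + 3)) \<noteq> b" using b(2)[of "i + 2"] by (simp add: add.assoc)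
  show *: "c x y = a \<or> c x y = b" using two a b b' by metis
  show "a \<noteq> b"
  proof
    assume "a = b"
    then have "c x y \<noteq> a"
    proof -
      have "x \<noteq> u i" "y \<noteq> u i" "u i \<in> V" using x y st by (auto simp: stuck_def pc_enum_in_V)
      then show ?thesis using no_mono[of x y "u i"] x(1) y(1) \<open>x \<noteq> y\<close> a(1) b(1) \<open>a = b\<close> by auto
    qed
    then show False using * \<open>a = b\<close> by simp
  qed
qed

text \<open>Otherwise the failure to replace \<open>u (j + 1)\<close> by \<open>x\<close>,
  \<open>y\<close> forces \<open>x y\<close> to have the color of \<open>x (u j)\<close>. This
  happens for two consecutive \<open>j\<close>, so two consecutive edges of the cycle share a
  color.\<close>

lemma stuck_fwd_const:
  assumes st: "stuck k u v" and x: "x \<in> V" "x \<notin> range u" "fwd u x"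
    and y: "y \<in> V" "y \<notin> range u" "const u y a"
  shows "c x y = a"
proof (rule ccontr)
  assume ne: "c x y \<noteq> a"
  have u: "pc_enum k u" using st by (simp add: stuck_def)
  have fx: "c x (u j) = c (u j) (u (j + 1))" for j using x by (simp add: fwd_def)
  have b: "c y (u j) = a" "c (u j) (u (j + 1)) \<noteq> a" for j
    using y(3) unfolding const_def by auto
  have "x \<noteq> y" using fx b by metis
  have "c x y = c x (u j)" if "v \<noteq> u (j + 1)" for j
    using stuck_replace_by_two[OF st x(1,2) y(1,2) \<open>x \<noteq> y\<close> that] ne fx[of j] b(1)[of "j + 2"]
      b(2)[of "j + 2"] pc_enum_pc'[OF u, of j] by (auto simp: add.assoc)
  moreover obtain i where "v \<noteq> u (i - 1 + 1)" "v \<noteq> u (i + 1)" using stuck_avoid[OF st] by auto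
  ultimately have "c x (u (i - 1)) = c x (u i)" by metis
  then show False using fx[of "i - 1"] fx[of i] pc_enum_pc'[OF u, of i] by simp
qed

lemma const_rev: "const (\<lambda>i. u (- i)) y a" if "const u y a"
proof -
  have "c (u (- i)) (u (- i - 1)) \<noteq> a" for i
    using that col_sym[of "u (- i)"] unfolding const_def by (metis diff_add_cancel)
  then show ?thesis using that by (simp add: const_def)
qed

lemma stuck_off_cycle_cases:
  assumes "stuck k u v" "x \<in> V" "x \<notin> range u"
  obtains (fwd) "fwd u x" | (bwd) "bwd u x" | (const) a where "const u x a"
proof -
  have u: "pc_enum k u" and v: "v \<in> range u" using assms(1) by (auto simp: stuck_def)
  have "\<not> pc_cycle (x # map u [i + 1..i + k])" for i
    using stuckD[OF assms(1), of "x # map u [i + 1..i + k]"] v pc_enum_range[OF u, of "i + k" "i + 1"] u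
    by (auto simp: pc_enum_def)
  then show ?thesis using off_cycle_cases[OF u assms(2,3)] that by blast
qed

text \<open>All vertices of constant type together are degenerate, each labelled by its constant;
  this is the color towards the cycle and towards all forward and backward vertices.\<close>

lemma stuck_const_degen:
  assumes st: "stuck k u v" and z: "z \<in> V" "z \<notin> range u" "const u z a"
  shows "\<exists>S. degen S \<and> S \<noteq> V"
proof -
  have u: "pc_enum k u" using st by (simp add: stuck_def)
  define S where "S = {y \<in> V - range u. \<exists>b. const u y b}"
  have col: "c x y = c x (u 0) \<or> y \<in> S \<and> c x y = c y (u 0)"
    if xy: "x \<in> S" "y \<in> V" "x \<noteq> y" for x y
  proof -
    obtain b where x: "x \<in> V" "x \<notin> range u" "const u x b"
      using xy by (auto simp: S_def)
    then have b: "b = c x (u 0)" by (simp add: const_def)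
    show ?thesis
    proof (cases "y \<in> range u")
      case True
      then show ?thesis using x b by (auto simp: const_def)
    next
      case False
      from st \<open>y \<in> V\<close> this show ?thesis
      proof (cases rule: stuck_off_cycle_cases)
        case fwd
        then show ?thesis using stuck_fwd_const[OF st _ _ _ x] False xy b by (simp add: col_sym[of x y])
      next
        case bwd
        have "x \<notin> range (\<lambda>i. u (- i))" "y \<notin> range (\<lambda>i. u (- i))" using x False by auto
        then show ?thesis
          using stuck_fwd_const[OF stuck_rev[OF st] \<open>y \<in> V\<close> _ _ x(1) _ const_rev[OF x(3)]] bwd b
          by (simp add: col_sym[of x y] fwd_rev)
      next
        case (const d)
        then have "y \<in> S" "c y (u 0) = d" using False xy by (auto simp: S_def const_def)
        then show ?thesis using stuck_const_same(2)[OF st x _ _ const] xy False b by auto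
      qed
    qed
  qed
  have "\<forall>x\<in>S. \<forall>y\<in>V. x \<noteq> y \<longrightarrow>
        (if y \<in> S then c x y = c x (u 0) \<or> c x y = c y (u 0) else c x y = c x (u 0))"
    using col by auto
  moreover have "z \<in> S" "S \<subseteq> V" using z by (auto simp: S_def)
  ultimately have "degen S" unfolding degen_def by (intro conjI exI[of _ "\<lambda>x. c x (u 0)"]) auto
  moreover have "S \<noteq> V" using pc_enum_in_V[OF u, of 0] by (auto simp: S_def)
  ultimately show ?thesis by blast
qed

lemma stuck_one_direction:
  assumes st: "stuck k u v" and nd: "\<And>S. degen S \<Longrightarrow> S = V"
  shows "(\<forall>y\<in>V - range u. fwd u y) \<or> (\<forall>y\<in>V - range u. bwd u y)"
proof -
  have "fwd u y \<or> bwd u y" if "y \<in> V - range u" for y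
    using stuck_off_cycle_cases[OF st, of y] stuck_const_degen[OF st, of y] nd that by (metis DiffE)
  then show ?thesis using stuck_not_fwd_bwd[OF st] by (metis DiffE)
qed

section \<open>Chords obstructing degeneracy of the cycle, and rerouting along them\<close>

definition bad_chord :: "int \<Rightarrow> (int \<Rightarrow> 'a) \<Rightarrow> int \<Rightarrow> int \<Rightarrow> bool" where
  "bad_chord k u p q \<longleftrightarrow> p < q \<and> q < p + k \<and>
     c (u p) (u q) \<noteq> c (u p) (u (p + 1)) \<and> c (u p) (u q) \<noteq> c (u q) (u (q + 1))"

text \<open>The labelling tried on the cycle is \<open>c x\<close>, which gives \<open>u i\<close>
  the color of its outgoing edge. Every vertex off the cycle is forward and sees the same color, so
  only a chord can violate degeneracy.\<close>

lemma ex_bad_chord: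
  assumes u: "pc_enum k u" and x: "x \<in> V" "x \<notin> range u" and fw: "\<forall>y\<in>V - range u. fwd u y"
    and nd: "\<not> degen (range u)"
  shows "\<exists>p q. bad_chord k u p q"
proof -
  have fx: "c y (u i) = c (u i) (u (i + 1))" if "y \<in> V" "y \<notin> range u" for y i
    using fw that by (auto simp: fwd_def)
  have "\<exists>y\<in>range u. \<exists>z\<in>range u. y \<noteq> z \<and> c y z \<noteq> c x y \<and> c y z \<noteq> c x z"
  proof (rule ccontr)
    assume *: "\<not> ?thesis"
    have "if z \<in> range u then c y z = c x y \<or> c y z = c x z else c y z = c x y"
      if "y \<in> range u" "z \<in> V" "y \<noteq> z" for y z
    proof (cases "z \<in> range u")
      case True
      then show ?thesis using * that by auto
    next
      case False
      then show ?thesis using that fx[of z] fx[OF x] col_sym[of y z] by auto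
    qed
    then have "degen (range u)"
      unfolding degen_def using pc_enum_in_V[OF u] by (intro conjI exI[of _ "c x"]) auto
    then show False using nd by simp
  qed
  then obtain p z where p: "z \<in> range u" "u p \<noteq> z" "c (u p) z \<noteq> c x (u p)" "c (u p) z \<noteq> c x z" by auto
  obtain q where q: "q \<in> {p..p + k - 1}" "z = u q"
    using p(1) pc_enum_range[OF u, of "p + k - 1" p] by auto
  then have "bad_chord k u p q" using p fx[OF x] by (cases "p = q") (auto simp: bad_chord_def)
  then show ?thesis by blast
qed

lemma bad_chord_far:
  assumes u: "pc_enum k u" and "bad_chord k u p q"
  shows "p + 2 \<le> q" "q + 2 \<le> p + k"
proof -
  have pq: "p < q" "q < p + k" and bad: "c (u p) (u q) \<noteq> c (u p) (u (p + 1))"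
      "c (u p) (u q) \<noteq> c (u q) (u (q + 1))"
    using assms by (auto simp: bad_chord_def)
  have "q \<noteq> p + 1" using bad by auto
  then show "p + 2 \<le> q" using pq by simp
  have "u (q + 1) \<noteq> u p" using bad col_sym[of "u p"] by auto
  then have "q + 1 \<noteq> p + k" using pc_enum_period[OF u, of p] by auto
  then show "q + 2 \<le> p + k" using pq by simp
qed

lemma bad_chord_swap:
  assumes u: "pc_enum k u" and "bad_chord k u p q"
  shows "bad_chord k u q (p + k)"
proof -
  have "u (p + k) = u p" "u (p + k + 1) = u (p + 1)"
    using pc_enum_period[OF u, of p] pc_enum_period[OF u, of "p + 1"] by (simp_all add: algebra_simps)
  then show ?thesis using assms(2) col_sym[of "u p" "u q"] by (simp add: bad_chord_def)
qed

text \<open>The cycle \<open>x\<close>, \<open>u (q - 1)\<close>, ..., \<open>u p\<close>,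
  \<open>u q\<close>, ..., \<open>u (p - 1)\<close> covers all of the old cycle and
  \<open>x\<close>. The chord is compatible with its neighbors because it is bad, so the only
  possible clash is at \<open>x\<close>, between the two colors stated to be equal.\<close>

lemma bad_chord_pred_colors:
  assumes st: "stuck k u v" and x: "x \<in> V" "x \<notin> range u" "fwd u x" and bad: "bad_chord k u p q"
  shows "c (u (p - 1)) (u p) = c (u (q - 1)) (u q)"
proof (rule ccontr)
  assume ne: "\<not> ?thesis"
  have u: "pc_enum k u" and v: "v \<in> range u" and k: "3 \<le> k" using st by (auto simp: stuck_def pc_enum_def)
  have far: "p + 2 \<le> q" "q + 2 \<le> p + k" using bad_chord_far[OF u bad] by auto
  have fx: "c x (u i) = c (u i) (u (i + 1))" for i using x by (simp add: fwd_def)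
  have b: "c (u p) (u q) \<noteq> c (u p) (u (p + 1))" "c (u p) (u q) \<noteq> c (u q) (u (q + 1))"
    using bad by (auto simp: bad_chord_def)
  have per: "u (p + k) = u p" "u (p + k - 1) = u (p - 1)"
    using pc_enum_period[OF u, of p] pc_enum_period[OF u, of "p - 1"] by (simp_all add: algebra_simps)
  let ?A = "map u (rev [p..q - 1])" and ?B = "map u [q..p + k - 1]"
  have A: "hd ?A = u (q - 1)" "last ?A = u p" "?A \<noteq> []" and B: "hd ?B = u q" "last ?B = u (p - 1)" "?B \<noteq> []"
    using far per by (simp_all flip: rev_map)
  have "pc_walk c (c (u (q - 1)) (u q)) ?A (c (u p) (u q))"
    by (rule pc_walk_rev_upto[where c = c and u = u, OF col_sym pc_enum_pc[OF u]])
      (use far b pc_enum_pc'[OF u, of "q - 1"] in auto)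
  moreover have "pc_walk c (c (u p) (u q)) ?B (c (u (p - 1)) (u p))"
    by (rule pc_walk_upto[where c = c and u = u, OF pc_enum_pc[OF u]])
      (use far b per pc_enum_pc'[OF u, of "p + k - 1"] in auto)
  moreover have dist: "distinct (?A @ ?B)"
  proof -
    have "inj_on u {p..p + k - 1}" by (rule pc_enum_inj[OF u]) simp
    moreover have "{p..q - 1} \<subseteq> {p..p + k - 1}" "{q..p + k - 1} \<subseteq> {p..p + k - 1}" using far by auto
    moreover have "u ` {p..q - 1} \<inter> u ` {q..p + k - 1} = u ` ({p..q - 1} \<inter> {q..p + k - 1})"
      using calculation by (intro inj_on_image_Int[symmetric]) auto
    ultimately show ?thesis by (auto simp: distinct_map intro: inj_on_subset)
  qed
  ultimately have "pc_cycle (x # ?A @ ?B)"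
    unfolding pc_cycle_def
    using A B far x k ne fx[of "q - 1"] fx[of "p - 1"] pc_enum_in_V[OF u] col_sym[of "u (p - 1)" x]
    by (auto simp: pc_walk_Cons pc_walk_append)
  moreover have "v \<in> set (x # ?A @ ?B)"
  proof -
    have "{p..p + k - 1} = {p..q - 1} \<union> {q..p + k - 1}" using far by auto
    then show ?thesis using v pc_enum_range[OF u, of "p + k - 1" p] by auto
  qed
  moreover have "int (length (x # ?A @ ?B)) = k + 1" using far by simp
  ultimately show False using stuckD[OF st] by blast
qed

text \<open>Skipping \<open>u (q - 1)\<close> in the rerouted cycle removes the clash at
  \<open>x\<close> and gives a PC cycle of length \<open>k\<close> that still contains
  \<open>v\<close>, hence is stuck as well. The conclusions are read off from the types of the
  vertices off this second cycle.\<close>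

lemma bad_chord_structure:
  assumes st: "stuck k u v" and nd: "\<And>S. degen S \<Longrightarrow> S = V"
    and fw: "\<forall>y\<in>V - range u. fwd u y" and x: "x \<in> V" "x \<notin> range u"
    and bad: "bad_chord k u p q" and v: "v \<noteq> u (q - 1)"
  shows "V = insert x (range u)"
    and "c (u p) (u q) = c (u (q - 1)) (u q)"
    and "\<And>j. \<lbrakk>p \<le> j; j \<le> q - 2\<rbrakk> \<Longrightarrow> c (u (q - 1)) (u j) = c (u j) (u (j + 1))"
    and "\<And>j. \<lbrakk>q + 1 \<le> j; j \<le> p + k - 1\<rbrakk> \<Longrightarrow> c (u (q - 1)) (u j) = c (u (j - 1)) (u j)"
proof -
  have u: "pc_enum k u" and vr: "v \<in> range u" and k: "3 \<le> k" using st by (auto simp: stuck_def pc_enum_def)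
  have far: "p + 2 \<le> q" "q + 2 \<le> p + k" using bad_chord_far[OF u bad] by auto
  have fx: "c x (u i) = c (u i) (u (i + 1))" for i using x fw by (simp add: fwd_def)
  have b: "c (u p) (u q) \<noteq> c (u p) (u (p + 1))" "c (u p) (u q) \<noteq> c (u q) (u (q + 1))"
    using bad by (auto simp: bad_chord_def)
  have pred: "c (u (p - 1)) (u p) = c (u (q - 1)) (u q)"
    using bad_chord_pred_colors[OF st x _ bad] x fw by auto
  have per: "u (p + k) = u p" "u (p + k - 1) = u (p - 1)"
    using pc_enum_period[OF u, of p] pc_enum_period[OF u, of "p - 1"] by (simp_all add: algebra_simps)
  let ?A = "map u (rev [p..q - 2])" and ?B = "map u [q..p + k - 1]"
  define C where "C = x # ?A @ ?B"
  have A: "hd ?A = u (q - 2)" "last ?A = u p" "?A \<noteq> []" and B: "hd ?B = u q" "last ?B = u (p - 1)" "?B \<noteq> []"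
    using far per by (simp_all flip: rev_map)
  have q2: "c (u (q - 2)) (u (q - 1)) \<noteq> c (u (q - 1)) (u q)" using pc_enum_pc'[OF u, of "q - 1"] by simp
  have "pc_walk c (c (u (q - 2)) (u (q - 1))) ?A (c (u p) (u q))"
    by (rule pc_walk_rev_upto[where c = c and u = u, OF col_sym pc_enum_pc[OF u]])
      (use far b pc_enum_pc'[OF u, of "q - 2"] in auto)
  moreover have "pc_walk c (c (u p) (u q)) ?B (c (u (p - 1)) (u p))"
    by (rule pc_walk_upto[where c = c and u = u, OF pc_enum_pc[OF u]])
      (use far b per pc_enum_pc'[OF u, of "p + k - 1"] in auto)
  moreover have inj: "inj_on u {p..p + k - 1}" by (rule pc_enum_inj[OF u]) simp
  have sub: "{p..q - 2} \<subseteq> {p..p + k - 1}" "{q..p + k - 1} \<subseteq> {p..p + k - 1}" using far by auto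
  have "u ` {p..q - 2} \<inter> u ` {q..p + k - 1} = u ` ({p..q - 2} \<inter> {q..p + k - 1})"
    using inj sub by (intro inj_on_image_Int[symmetric]) auto
  then have dist: "distinct (?A @ ?B)"
    using inj sub by (auto simp: distinct_map intro: inj_on_subset)
  ultimately have C: "pc_cycle C"
    unfolding pc_cycle_def C_def
    using A B far x k q2 fx[of "q - 2"] fx[of "p - 1"] pc_enum_in_V[OF u] col_sym[of "u (p - 1)" x] pred dist
    by (auto simp: pc_walk_Cons pc_walk_append)
  have len: "int (length C) = k" using far by (simp add: C_def)
  define w where "w = (\<lambda>i. C ! nat (i mod k))"
  have w: "pc_enum k w" using pc_cycle_enum[OF C] by (simp add: len w_def)
  have wA: "w (q - 1 - j) = u j" if "p \<le> j" "j \<le> q - 2" for j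
  proof -
    have "(q - 1 - j) mod k = q - 1 - j" using that far by (intro mod_pos_pos_trivial) auto
    moreover have "nat (q - 1 - j) = Suc (nat (q - 2 - j))" using that by simp
    moreover have "?A ! nat (q - 2 - j) = u j" using that by (simp add: rev_nth nth_upto)
    ultimately show ?thesis using that unfolding w_def C_def by (simp add: nth_append)
  qed
  have wB: "w (j - p) = u j" if "q \<le> j" "j \<le> p + k - 1" for j
  proof -
    have "(j - p) mod k = j - p" using that far by (intro mod_pos_pos_trivial) auto
    moreover have "nat (j - p) = Suc (length ?A + nat (j - q))" using that far by simp
    moreover have "?B ! nat (j - q) = u j" using that by (simp add: nth_upto)
    ultimately show ?thesis unfolding w_def C_def by (simp only: nth_Cons_Suc nth_append_length_plus)
  qed
  have w0: "w 0 = x" by (simp add: w_def C_def)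
  have rangew: "range w = insert x (range u - {u (q - 1)})"
  proof -
    have "range w = set C"
    proof
      show "range w \<subseteq> set C"
      proof -
        have "nat (i mod k) < length C" for i
          using len k pos_mod_bound[of k i] pos_mod_sign[of k i] by linarith
        then show ?thesis by (auto simp: w_def)
      qed
      show "set C \<subseteq> range w"
      proof
        fix y assume "y \<in> set C"
        then obtain n where "n < length C" "y = C ! n" by (auto simp: in_set_conv_nth)
        then have "y = w (int n)" using len by (simp add: w_def mod_pos_pos_trivial)
        then show "y \<in> range w" by simp
      qed
    qed
    also have "set C = insert x (u ` ({p..q - 2} \<union> {q..p + k - 1}))" by (auto simp: C_def)
    also have "{p..q - 2} \<union> {q..p + k - 1} = {p..p + k - 1} - {q - 1}" using far by auto
    also have "u ` \<dots> = range u - {u (q - 1)}"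
      using inj_on_image_set_diff[OF inj, of "{p..p + k - 1}" "{q - 1}"] far
        pc_enum_range[OF u, of "p + k - 1" p] by auto
    finally show ?thesis .
  qed
  have y: "u (q - 1) \<in> V" "u (q - 1) \<notin> range w" using rangew x pc_enum_in_V[OF u] by auto
  have "stuck k w v" using st w v vr rangew by (auto simp: stuck_def)
  from stuck_one_direction[OF this nd] have "\<forall>y\<in>V - range w. bwd w y"
  proof
    \<comment> \<open>Forward type on \<open>w\<close> would give \<open>x (u (q - 1))\<close> the
      color of \<open>x (u (q - 2))\<close>, but \<open>x\<close> is forward on \<open>u\<close>, so
      these are the colors of consecutive edges of \<open>u\<close>.\<close>
    assume "\<forall>y\<in>V - range w. fwd w y"
    then have "c (u (q - 1)) (w 0) = c (w 0) (w 1)" using y by (auto simp: fwd_def)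
    moreover have "w 1 = u (q - 2)" using wA[of "q - 2"] far by simp
    ultimately have False using fx[of "q - 2"] fx[of "q - 1"] q2 w0 col_sym[of x "u (q - 1)"] by simp
    then show ?thesis ..
  qed
  then have bw: "c y (w i) = c (w (i - 1)) (w i)" if "y \<in> V" "y \<notin> range w" for y i
    using that by (auto simp: bwd_def)
  have wq: "w (q - p) = u q" "w (q - p - 1) = u p"
    using wB[of q] wA[of p] far by (simp_all add: algebra_simps)
  show V: "V = insert x (range u)"
  proof -
    \<comment> \<open>Such a vertex would be backward on \<open>w\<close> and forward on
      \<open>u\<close>. At \<open>u q\<close> this equates the color of the chord with that of the
      edge leaving \<open>u q\<close>.\<close>
    have False if "y \<in> V" "y \<notin> range u" "y \<noteq> x" for y
    proof -
      have "c y (u q) = c (u p) (u q)" using bw[of y "q - p"] that rangew wq by auto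
      moreover have "c y (u q) = c (u q) (u (q + 1))" using fw that by (auto simp: fwd_def)
      ultimately show False using b by simp
    qed
    then show ?thesis using x pc_enum_in_V[OF u] by auto
  qed
  show "c (u p) (u q) = c (u (q - 1)) (u q)" using bw[OF y, of "q - p"] wq by simp
  show "c (u (q - 1)) (u j) = c (u j) (u (j + 1))" if j: "p \<le> j" "j \<le> q - 2" for j
  proof (cases "j = q - 2")
    \<comment> \<open>The vertex before \<open>u (q - 2)\<close> on \<open>w\<close> is
      \<open>x\<close>; for smaller \<open>j\<close> it is \<open>u (j + 1)\<close>, as this part is
      traversed downwards.\<close>
    case True
    then show ?thesis using bw[OF y, of 1] wA[of j] w0 j fx[of j] by simp
  next
    case False
    have "c (u (q - 1)) (w (q - 1 - j)) = c (w (q - 1 - j - 1)) (w (q - 1 - j))" by (rule bw[OF y])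
    then show ?thesis
      using wA[of j] wA[of "j + 1"] j False col_sym[of "u (j + 1)" "u j"] by (simp add: algebra_simps)
  qed
  show "c (u (q - 1)) (u j) = c (u (j - 1)) (u j)" if "q + 1 \<le> j" "j \<le> p + k - 1" for j
  proof -
    have "c (u (q - 1)) (w (j - p)) = c (w (j - p - 1)) (w (j - p))" by (rule bw[OF y])
    then show ?thesis using wB[of j] wB[of "j - 1"] that by (simp add: algebra_simps)
  qed
qed

text \<open>Reading the chord from each of its ends determines the color of
  \<open>u (p - 1) u (q - 1)\<close> twice: it is the color entering \<open>u (p - 1)\<close> and
  also the color entering \<open>u (q - 1)\<close>, hence it is neither outgoing color.\<close>

lemma bad_chord_shift:
  assumes u: "pc_enum k u" and x: "x \<in> V" "x \<notin> range u"
    and nd: "\<And>S. degen S \<Longrightarrow> S = V" and fw: "\<forall>y\<in>V - range u. fwd u y"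
    and st: "\<And>v. v \<in> range u \<Longrightarrow> stuck k u v"
    and bad: "bad_chord k u p q"
  shows "bad_chord k u (p - 1) (q - 1)"
proof -
  have far: "p + 2 \<le> q" "q + 2 \<le> p + k" using bad_chord_far[OF u bad] by auto
  have bad': "bad_chord k u q (p + k)" by (rule bad_chord_swap[OF u bad])
  have per: "u (p + k - 1) = u (p - 1)" "u (p + k - 2) = u (p - 2)"
    using pc_enum_period[OF u, of "p - 1"] pc_enum_period[OF u, of "p - 2"] by (simp_all add: algebra_simps)
  have ne: "u q \<noteq> u (q - 1)" "u p \<noteq> u (p + k - 1)"
    using pc_enum_neq[OF u, of "q - 1" q] pc_enum_neq[OF u, of "p - 1" p] per far by auto
  note s1 = bad_chord_structure[OF st nd fw x bad ne(1), OF rangeI]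
  note s2 = bad_chord_structure[OF st nd fw x bad' ne(2), OF rangeI]
  have "c (u (q - 1)) (u (p - 1)) = c (u (p - 2)) (u (p - 1))"
    using s1(4)[of "p + k - 1"] far per by (simp add: algebra_simps)
  moreover have "c (u (p - 1)) (u (q - 1)) = c (u (q - 2)) (u (q - 1))"
    using s2(4)[of "q - 1 + k"] far per pc_enum_period[OF u, of "q - 1"] pc_enum_period[OF u, of "q - 2"]
    by (simp add: algebra_simps)
  ultimately show ?thesis
    using bad col_sym[of "u (q - 1)"] pc_enum_pc'[OF u, of "p - 1"] pc_enum_pc'[OF u, of "q - 1"]
    by (simp add: bad_chord_def)
qed

text \<open>For a longer chord, the structure of the chord and of a rotated copy of it assign to
  \<open>u (p - 1) u (p + 1)\<close> the colors of two consecutive edges of the cycle.\<close>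

lemma bad_chord_length_2:
  assumes u: "pc_enum k u" and x: "x \<in> V" "x \<notin> range u"
    and nd: "\<And>S. degen S \<Longrightarrow> S = V" and fw: "\<forall>y\<in>V - range u. fwd u y"
    and st: "\<And>v. v \<in> range u \<Longrightarrow> stuck k u v"
    and bad: "bad_chord k u p q"
  shows "q = p + 2"
proof (rule ccontr)
  assume "q \<noteq> p + 2"
  then have far: "p + 3 \<le> q" "q + 2 \<le> p + k" using bad_chord_far[OF u bad] by auto
  have shift: "bad_chord k u (p - int t) (q - int t)" for t
  proof (induction t)
    case (Suc t)
    have "p - int (Suc t) = p - int t - 1" "q - int (Suc t) = q - int t - 1" by auto
    then show ?case using bad_chord_shift[OF u x nd fw st Suc] by (simp only:)
  qed (use bad in simp)
  \<comment> \<open>Rotating by \<open>q - p - 2\<close> moves the end \<open>q\<close> to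
    \<open>p + 2\<close>, so that \<open>u (p + 1)\<close> is the skipped vertex;
    \<open>q \<ge> p + 3\<close> puts \<open>p - 1\<close> in the range of the third structure
    claim.\<close>
  define p' where "p' = p - (q - p - 2)"
  have bad2: "bad_chord k u p' (p + 2)" using shift[of "nat (q - p - 2)"] far by (simp add: p'_def)
  have per: "u (p + k - 1) = u (p - 1)" "u (p + k) = u p"
    using pc_enum_period[OF u, of "p - 1"] pc_enum_period[OF u, of "p"] by (simp_all add: algebra_simps)
  have ne: "u p \<noteq> u (p + k - 1)" "u (p + 2) \<noteq> u (p + 2 - 1)"
    using pc_enum_neq[OF u, of "p - 1" p] pc_enum_neq[OF u, of "1 + p" "p + 2"] per far by auto
  have "c (u (p - 1)) (u (p + 1)) = c (u p) (u (p + 1))"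
    using bad_chord_structure(4)[OF st nd fw x bad_chord_swap[OF u bad] ne(1), OF rangeI, of "p + 1 + k"]
      far per pc_enum_period[OF u, of "p + 1"] by (simp add: algebra_simps)
  moreover have "c (u (p + 2 - 1)) (u (p - 1)) = c (u (p - 1)) (u (p - 1 + 1))"
    by (rule bad_chord_structure(3)[OF st nd fw x bad2 ne(2), OF rangeI]) (use far p'_def in auto)
  ultimately show False using pc_enum_pc'[OF u, of p] col_sym[of "u (p + 1)" "u (p - 1)"] by (simp add: add.commute)
qed

section \<open>The exceptional coloring on five vertices\<close>

definition two_pentagons :: bool where
  "two_pentagons \<longleftrightarrow> (\<exists>a b d e z. distinct [z, a, b, d, e] \<and> V = {z, a, b, d, e} \<and>
     c z a = c a b \<and> c a b = c b e \<and> c b e = c e d \<and> c e d = c d z \<and>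
     c z b = c b d \<and> c b d = c d a \<and> c d a = c a e \<and> c a e = c e z \<and> c z a \<noteq> c z b)"

text \<open>Both the chord and the same chord read from its other end have span two, so
  \<open>k = 4\<close>. Both diagonals are then bad, and their structure fixes all ten
  colors.\<close>

lemma stuck_pentagons_fwd:
  assumes st: "stuck k u v" and nd: "\<And>S. degen S \<Longrightarrow> S = V"
    and fw: "\<forall>y\<in>V - range u. fwd u y" and x: "x \<in> V" "x \<notin> range u"
  shows two_pentagons
proof -
  have u: "pc_enum k u" and v: "v \<in> range u" and k: "3 \<le> k" using st by (auto simp: stuck_def pc_enum_def)
  have fx: "c x (u i) = c (u i) (u (i + 1))" for i using x fw by (simp add: fwd_def)
  obtain p0 q0 where bad0: "bad_chord k u p0 q0"
    using ex_bad_chord[OF u x fw] nd x by blast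
  \<comment> \<open>The two readings of the chord skip different vertices, so at least one of them
    keeps \<open>v\<close>.\<close>
  have Vx: "V = insert x (range u)"
  proof (cases "v = u (q0 - 1)")
    case False
    then show ?thesis using bad_chord_structure(1)[OF st nd fw x bad0] by blast
  next
    case True
    have far: "p0 + 2 \<le> q0" "q0 + 2 \<le> p0 + k" using bad_chord_far[OF u bad0] by auto
    have "v \<noteq> u (p0 + k - 1)" using True pc_enum_neq[OF u, of "q0 - 1" "p0 + k - 1"] far by auto
    then show ?thesis using bad_chord_structure(1)[OF st nd fw x bad_chord_swap[OF u bad0]] by blast
  qed
  have cardV: "int (card V) = k + 1"
  proof -
    have "card (range u) = nat k"
      using pc_enum_range[OF u, of "k - 1" 0] card_image[OF pc_enum_inj[OF u, of "k - 1" 0]] by simp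
    moreover have "finite (range u)" using pc_enum_range[OF u, of "k - 1" 0] by simp
    ultimately show ?thesis using Vx x k by simp
  qed
  \<comment> \<open>As \<open>card V = k + 1\<close>, a PC cycle of length \<open>k + 1\<close>
    would be Hamiltonian and contain \<open>v\<close>; so the cycle is stuck for each of its
    vertices.\<close>
  have st': "stuck k u v'" if "v' \<in> range u" for v'
  proof -
    have "set xs = V" if "pc_cycle xs" "int (length xs) = k + 1" for xs
    proof (rule card_subset_eq[OF finite_V])
      show "set xs \<subseteq> V" "card (set xs) = card V"
        using that cardV by (auto simp: pc_cycle_def distinct_card)
    qed
    then show ?thesis using st that Vx v unfolding stuck_def by (metis insertCI)
  qed
  have len2: "q = p + 2" if "bad_chord k u p q" for p q
    by (rule bad_chord_length_2[OF u x nd fw st' that])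
  have bad: "bad_chord k u p0 (p0 + 2)" using len2 bad0 by auto
  have k4: "k = 4" using len2[OF bad_chord_swap[OF u bad]] by simp
  have bad1: "bad_chord k u (p0 - 1) (p0 + 1)" using bad_chord_shift[OF u x nd fw st' bad] by (simp add: add.commute)
  define r where "r = p0 - 1"
  have b1: "bad_chord k u r (r + 2)" and b2: "bad_chord k u (r + 1) (r + 3)"
    using bad bad1 by (simp_all add: r_def add.commute)
  have per: "u (r - 1) = u (r + 3)" "u (r + 4) = u r"
    using pc_enum_period[OF u, of "r - 1"] pc_enum_period[OF u, of r] k4 by (simp_all add: algebra_simps)
  define f where "f i = c (u i) (u (i + 1))" for i
  have "c (u (r - 1)) (u r) = c (u (r + 2 - 1)) (u (r + 2))"
    using bad_chord_pred_colors[OF st x _ b1] x fw by auto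
  then have e1: "c (u (r + 3)) (u r) = c (u (r + 1)) (u (r + 2))" using per by (simp add: algebra_simps)
  have "c (u (r + 1 - 1)) (u (r + 1)) = c (u (r + 3 - 1)) (u (r + 3))"
    using bad_chord_pred_colors[OF st x _ b2] x fw by auto
  then have e2: "c (u r) (u (r + 1)) = c (u (r + 2)) (u (r + 3))" by (simp add: algebra_simps)
  have n1: "u r \<noteq> u (r + 2 - 1)" "u r \<noteq> u (r + 3 - 1)"
    using pc_enum_neq[OF u, of r "1 + r"] pc_enum_neq[OF u, of r "2 + r"] k4 by auto
  have "c (u r) (u (r + 2)) = c (u (r + 2 - 1)) (u (r + 2))"
    by (rule bad_chord_structure(2)[OF st' nd fw x b1 n1(1)]) auto
  then have e3: "c (u r) (u (r + 2)) = c (u (r + 1)) (u (r + 2))" by (simp add: algebra_simps)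
  have "c (u (r + 1)) (u (r + 3)) = c (u (r + 3 - 1)) (u (r + 3))"
    by (rule bad_chord_structure(2)[OF st' nd fw x b2 n1(2)]) auto
  then have e4: "c (u (r + 1)) (u (r + 3)) = c (u (r + 2)) (u (r + 3))" by (simp add: algebra_simps)
  have "{r..r + 3} = {r, r + 1, r + 2, r + 3}" by auto
  then have V: "V = {x, u r, u (r + 1), u (r + 2), u (r + 3)}"
    using Vx pc_enum_range[OF u, of "r + 3" r] k4 by simp
  have fxs: "c x (u r) = c (u r) (u (r + 1))" "c x (u (r + 1)) = c (u (r + 1)) (u (r + 2))"
    "c x (u (r + 2)) = c (u (r + 2)) (u (r + 3))" "c x (u (r + 3)) = c (u (r + 3)) (u r)"
    using fx[of r] fx[of "r + 1"] fx[of "r + 2"] fx[of "r + 3"] per by (simp_all add: add.assoc)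
  have "distinct [x, u r, u (r + 1), u (r + 2), u (r + 3)]"
    using x k4 pc_enum_neq[OF u, of r "r + 1"] pc_enum_neq[OF u, of r "r + 2"] pc_enum_neq[OF u, of r "r + 3"]
      pc_enum_neq[OF u, of "r + 1" "r + 2"] pc_enum_neq[OF u, of "r + 1" "r + 3"]
      pc_enum_neq[OF u, of "r + 2" "r + 3"] by auto
  moreover have "c (u (r + 3)) (u (r + 2)) = c (u r) (u (r + 1))" "c (u (r + 2)) x = c (u r) (u (r + 1))"
    "c (u (r + 1)) (u (r + 3)) = c (u r) (u (r + 1))" "c x (u r) = c (u r) (u (r + 1))"
    "c x (u (r + 1)) = c (u (r + 1)) (u (r + 2))" "c (u (r + 2)) (u r) = c (u (r + 1)) (u (r + 2))"
    "c (u r) (u (r + 3)) = c (u (r + 1)) (u (r + 2))" "c (u (r + 3)) x = c (u (r + 1)) (u (r + 2))"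
    using e1 e2 e3 e4 fxs by (metis col_sym)+
  ultimately show ?thesis
    unfolding two_pentagons_def using V pc_enum_pc[OF u, of r]
    by (intro exI[of _ "u r"] exI[of _ "u (r + 1)"] exI[of _ "u (r + 2)"] exI[of _ "u (r + 3)"] exI[of _ x])
      (simp only: simp_thms)
qed

section \<open>Lengthening cycles step by step from a short one\<close>

lemma pc_cycle_extend:
  assumes xs: "pc_cycle xs" "v \<in> set xs" "length xs < card V" and nd: "\<And>S. degen S \<Longrightarrow> S = V"
    and np: "\<not> two_pentagons"
  shows "\<exists>ys. pc_cycle ys \<and> v \<in> set ys \<and> length ys = length xs + 1"
proof (rule ccontr)
  assume no: "\<not> ?thesis"
  define k where "k = int (length xs)"
  define u where "u = (\<lambda>i. xs ! nat (i mod k))"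
  have u: "pc_enum k u" unfolding u_def k_def by (rule pc_cycle_enum[OF xs(1)])
  have k: "3 \<le> k" using u by (simp add: pc_enum_def)
  have r: "range u = set xs"
  proof
    have "nat (i mod k) < length xs" for i
      using k pos_mod_bound[of k i] pos_mod_sign[of k i] k_def by linarith
    then show "range u \<subseteq> set xs" by (auto simp: u_def)
    show "set xs \<subseteq> range u"
    proof
      fix y assume "y \<in> set xs"
      then obtain n where "n < length xs" "y = xs ! n" by (auto simp: in_set_conv_nth)
      then have "y = u (int n)" by (simp add: u_def k_def)
      then show "y \<in> range u" by simp
    qed
  qed
  have st: "stuck k u v" using u r xs no by (auto simp: stuck_def k_def)
  have "card (set xs) < card V" using xs by (simp add: pc_cycle_def distinct_card)
  moreover have "set xs \<subseteq> V" using xs by (simp add: pc_cycle_def)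
  ultimately obtain x where x: "x \<in> V" "x \<notin> range u" using r by (metis less_irrefl subsetI subset_antisym)
  from stuck_one_direction[OF st nd] show False
  proof
    assume "\<forall>y\<in>V - range u. fwd u y"
    then show False using stuck_pentagons_fwd[OF st nd _ x] np by blast
  next
    \<comment> \<open>Reversing the cycle turns backward type into forward type.\<close>
    assume *: "\<forall>y\<in>V - range u. bwd u y"
    have "u i \<in> range (\<lambda>i. u (- i))" for i using rangeI[of "\<lambda>i. u (- i)" "- i"] by simp
    then have "range (\<lambda>i. u (- i)) = range u" by blast
    then show False using stuck_pentagons_fwd[OF stuck_rev[OF st] nd _ x(1)] np x * by (simp add: fwd_rev)
  qed
qed

lemma ex_short_pc_cycle:
  assumes v: "v \<in> V" and V: "V \<noteq> {v}" and nd: "\<And>S. degen S \<Longrightarrow> S = V"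
  shows "\<exists>xs. pc_cycle xs \<and> v \<in> set xs \<and> length xs \<in> {3, 4}"
proof (rule ccontr)
  assume no: "\<not> ?thesis"
  have tri: "c x y = c v x \<or> c x y = c v y"
    if "x \<in> V - {v}" "y \<in> V - {v}" "c v x \<noteq> c v y" for x y
  proof (rule ccontr)
    assume "\<not> ?thesis"
    then have "pc_cycle [v, x, y]"
      using that v col_sym[of y v] by (auto simp: pc_cycle_def)
    then show False using no by force
  qed
  \<comment> \<open>Otherwise \<open>y z\<close> repeats the color of \<open>v y\<close>, whereas
    \<open>x y\<close> cannot, lest \<open>v\<close>, \<open>x\<close>, \<open>y\<close> be
    monochromatic. Then \<open>v\<close>, \<open>x\<close>, \<open>y\<close>, \<open>z\<close> is a
    PC 4-cycle.\<close>
  have big: "c y z = c v z"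
    if "x \<in> V - {v}" "y \<in> V - {v}" "z \<in> V - {v}" "x \<noteq> y" "c v x = c v y" "c v z \<noteq> c v y" for x y z
  proof (rule ccontr)
    assume "\<not> ?thesis"
    then have "c y z = c v y" using tri[of y z] that by auto
    moreover have "c x y \<noteq> c v x" using no_mono[of v x y] that v by auto
    ultimately have "pc_cycle [v, x, y, z]"
      using that v col_sym[of z v] by (auto simp: pc_cycle_def)
    then show False using no by force
  qed
  \<comment> \<open>The vertices alone in their color class at \<open>v\<close>. By
    \<open>tri\<close> and \<open>big\<close> they form a degenerate set with labels
    \<open>c v\<close> if there are any, and \<open>v\<close> is not among them.\<close>
  define S where "S = {x \<in> V - {v}. \<forall>y\<in>V - {v}. c v y = c v x \<longrightarrow> y = x}"
  have "S = {}"
  proof (rule ccontr)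
    assume "S \<noteq> {}"
    have deg_S: "if y \<in> S then c x y = c v x \<or> c x y = c v y else c x y = c v x"
      if x: "x \<in> S" and y: "y \<in> V" "x \<noteq> y" for x y
    proof (cases "y = v")
      case True
      then show ?thesis using col_sym[of x v] by simp
    next
      case False
      then have ne: "c v y \<noteq> c v x" using x y by (auto simp: S_def)
      show ?thesis
      proof (cases "y \<in> S")
        case True
        then show ?thesis using tri[of x y] x ne by (auto simp: S_def)
      next
        case nS: False
        then obtain y' where "y' \<in> V - {v}" "c v y' = c v y" "y' \<noteq> y" using False y by (auto simp: S_def)
        then show ?thesis using big[of y' y x] x y False ne nS col_sym[of x y] by (auto simp: S_def)
      qed
    qed
    have "S \<subseteq> V" by (auto simp: S_def)
    with \<open>S \<noteq> {}\<close> have "degen S"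
      unfolding degen_def by (intro conjI exI[of _ "c v"] ballI impI deg_S)
    then show False using nd v by (auto simp: S_def)
  qed
  \<comment> \<open>With two classes, each of size at least two, \<open>big\<close> would give
    \<open>x y\<close> both class colors.\<close>
  have eq: "c v x = c v y" if xy: "x \<in> V - {v}" "y \<in> V - {v}" for x y
  proof (rule ccontr)
    assume ne: "c v x \<noteq> c v y"
    obtain x' where "x' \<in> V - {v}" "c v x' = c v x" "x' \<noteq> x" using \<open>S = {}\<close> xy by (auto simp: S_def)
    moreover obtain y' where "y' \<in> V - {v}" "c v y' = c v y" "y' \<noteq> y" using \<open>S = {}\<close> xy by (auto simp: S_def)
    ultimately show False using big[of x' x y] big[of y' y x] xy ne col_sym[of x y] by auto
  qed
  obtain z where z: "z \<in> V - {v}" using V v by blast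
  have "c v y = c v z" if "y \<in> V" "y \<noteq> v" for y using eq[OF _ z] that by blast
  then have "degen {v}" unfolding degen_def using v by (intro conjI exI[of _ "\<lambda>_. c v z"]) auto
  then show False using nd V by blast
qed

lemma vertex_pancyclic:
  assumes v: "v \<in> V" and V: "V \<noteq> {v}" and nd: "\<And>S. degen S \<Longrightarrow> S = V" and np: "\<not> two_pentagons"
    and l: "4 \<le> l" "l \<le> card V"
  shows "\<exists>xs. pc_cycle xs \<and> v \<in> set xs \<and> length xs = l"
  using l
proof (induction l rule: dec_induct)
  case base
  obtain xs where xs: "pc_cycle xs" "v \<in> set xs" "length xs \<in> {3, 4}"
    using ex_short_pc_cycle[OF v V nd] by blast
  then show ?case using pc_cycle_extend[OF xs(1,2) _ nd np] base by (cases "length xs = 3") auto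
next
  case (step l)
  then obtain xs where "pc_cycle xs" "v \<in> set xs" "length xs = l" by auto
  then show ?case using pc_cycle_extend[of xs v] nd np step by auto
qed

section \<open>From enumerations back to edge-colored graphs\<close>

lemma properly_colored_cycle_edges:
  assumes xs: "pc_cycle xs" and col: "\<And>x y. col G {x, y} = c x y"
  shows "properly_colored G (cycle_edges xs)"
proof -
  define k where "k = int (length xs)"
  define u where "u = (\<lambda>i. xs ! nat (i mod k))"
  have u: "pc_enum k u" unfolding u_def k_def by (rule pc_cycle_enum[OF xs(1)])
  have next_eq: "u (i + 1) = u (j + 1)" if "u i = u j" for i j
    using that u by (simp add: pc_enum_def)
  have prev_eq: "u i = u j" if "u (i + 1) = u (j + 1)" for i j
    using that u by (simp add: pc_enum_def)
  have edge: "\<exists>i. e = {u i, u (i + 1)}" if e: "e \<in> cycle_edges xs" for e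
  proof -
    obtain i where i: "i < length xs" "e = {xs ! i, xs ! (Suc i mod length xs)}"
      using e by (auto simp: cycle_edges_def)
    have "nat ((int i + 1) mod k) = Suc i mod length xs"
      unfolding k_def by (metis Suc_eq_plus1 nat_int of_nat_Suc of_nat_mod add.commute)
    then have "e = {u (int i), u (int i + 1)}" using i by (simp add: u_def k_def)
    then show ?thesis by blast
  qed
  have adj: "c (u i) (u (i + 1)) \<noteq> c (u j) (u (j + 1))" if "u i = u (j + 1)" for i j
    using pc_enum_pc[OF u, of j] next_eq[OF that] that by (simp add: add.assoc)
  show ?thesis unfolding properly_colored_def
  proof (intro ballI impI)
    fix e e' assume *: "e \<in> cycle_edges xs" "e' \<in> cycle_edges xs" "e \<noteq> e' \<and> e \<inter> e' \<noteq> {}"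
    then obtain i j where ij: "e = {u i, u (i + 1)}" "e' = {u j, u (j + 1)}" using edge by metis
    \<comment> \<open>Distinct edges of the cycle have distinct first and distinct second ends, so a
      shared vertex makes them consecutive.\<close>
    have "u i \<noteq> u j" "u (i + 1) \<noteq> u (j + 1)" using * ij next_eq prev_eq by metis+
    then have "u i = u (j + 1) \<or> u j = u (i + 1)" using * ij by auto
    then show "col G e \<noteq> col G e'" using adj[of i j] adj[of j i] ij col by auto
  qed
qed

end

theorem theorem1:
  fixes G :: "'a ec_graph" and n :: nat
  assumes "n \<ge> 4"
    and "edge_colored_complete n G"
    and "\<not> (\<exists>T. is_cycle G T \<and> length T = 3 \<and> monochromatic G (cycle_edges T))"
  shows "(\<forall>v\<in>verts G. \<forall>l. 4 \<le> l \<and> l \<le> n \<longrightarrow>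
            (\<exists>C. is_cycle G C \<and> length C = l \<and> v \<in> set C \<and> properly_colored G (cycle_edges C)))
       \<or> (\<exists>S. degenerate_set G S \<and> S \<noteq> verts G)
       \<or> two_mono_pentagons G"
proof -
  define c where "c x y = col G {x, y}" for x y
  have fin: "finite (verts G)" and card: "card (verts G) = n"
    using assms(2) by (auto simp: edge_colored_complete_def edge_colored_graph_def)
  have edge: "{x, y} \<in> edges G \<longleftrightarrow> x \<in> verts G \<and> y \<in> verts G \<and> x \<noteq> y" for x y
    using assms(2) by (auto simp: edge_colored_complete_def edge_colored_graph_def)
  have edgeE: "\<exists>x y. e = {x, y} \<and> x \<in> verts G \<and> y \<in> verts G \<and> x \<noteq> y" if "e \<in> edges G" for e
    using assms(2) that unfolding edge_colored_complete_def edge_colored_graph_def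
    by (metis card_2_iff insert_subset)
  interpret no_mono_triangle "verts G" c
  proof
    fix x y z assume *: "x \<in> verts G" "y \<in> verts G" "z \<in> verts G" "x \<noteq> y" "y \<noteq> z" "x \<noteq> z"
    then have "is_cycle G [x, y, z]" by (auto simp: is_cycle_def cycle_edges_3 edge)
    then have "\<not> monochromatic G (cycle_edges [x, y, z])" using assms(3) by fastforce
    then show "\<not> (c x y = c x z \<and> c x y = c y z)"
      by (auto simp: monochromatic_def cycle_edges_3 c_def insert_commute)
  qed (auto simp: fin c_def insert_commute)
  have cyc: "is_cycle G xs \<and> properly_colored G (cycle_edges xs)" if "pc_cycle xs" for xs
  proof
    show "properly_colored G (cycle_edges xs)"
      using properly_colored_cycle_edges[OF that] by (simp add: c_def)
    have xs: "3 \<le> length xs" "distinct xs" "set xs \<subseteq> verts G" using that by (auto simp: pc_cycle_def)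
    have "{xs ! i, xs ! (Suc i mod length xs)} \<in> edges G" if i: "i < length xs" for i
    proof -
      have "Suc i mod length xs < length xs" "Suc i mod length xs \<noteq> i"
        using i xs(1) by (auto simp: mod_Suc)
      then show ?thesis using i xs by (auto simp: edge nth_eq_iff_index_eq)
    qed
    then show "is_cycle G xs" using xs by (auto simp: is_cycle_def cycle_edges_def)
  qed
  have deg: "degenerate_set G S" if "degen S" for S
    using that unfolding degen_def degenerate_set_def edge c_def by (metis DiffD1 DiffD2 subsetD)
  show ?thesis
  proof (cases "(\<exists>S. degen S \<and> S \<noteq> verts G) \<or> two_pentagons")
    case False
    then have "\<exists>xs. pc_cycle xs \<and> v \<in> set xs \<and> length xs = l" if "v \<in> verts G" "4 \<le> l" "l \<le> n" for v l
      using vertex_pancyclic[of v l] that card by force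
    then show ?thesis using cyc by blast
  next
    case True
    then consider S where "degen S" "S \<noteq> verts G" | two_pentagons by blast
    then show ?thesis
    proof cases
      case 1
      then show ?thesis using deg by blast
    next
      case 2
      then obtain a b d e z where dist: "distinct [z, a, b, d, e]" and V: "verts G = {z, a, b, d, e}"
        and eqs: "c z a = c a b" "c a b = c b e" "c b e = c e d" "c e d = c d z"
          "c z b = c b d" "c b d = c d a" "c d a = c a e" "c a e = c e z" "c z a \<noteq> c z b"
        unfolding two_pentagons_def by blast
      \<comment> \<open>The orders follow the two chains of equal colors in
        \<open>two_pentagons\<close>.\<close>
      let ?C = "[z, a, b, e, d]" and ?D = "[z, b, d, a, e]"
      have "n = 5" using card V dist by simp
      moreover have cC: "is_cycle G ?C" and cD: "is_cycle G ?D"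
        using dist V by (auto simp: is_cycle_def cycle_edges_5 edge)
      moreover have mC: "col G f = c z a" if "f \<in> cycle_edges ?C" for f
        using that eqs by (auto simp: cycle_edges_5 c_def)
      moreover have mD: "col G f = c z b" if "f \<in> cycle_edges ?D" for f
        using that eqs by (auto simp: cycle_edges_5 c_def)
      moreover have "edges G = cycle_edges ?C \<union> cycle_edges ?D"
      proof
        show "cycle_edges ?C \<union> cycle_edges ?D \<subseteq> edges G" using cC cD by (auto simp: is_cycle_def)
        show "edges G \<subseteq> cycle_edges ?C \<union> cycle_edges ?D"
        proof
          fix f assume "f \<in> edges G"
          then obtain x y where f: "f = {x, y}" and xy: "x \<in> {z, a, b, d, e}" "y \<in> {z, a, b, d, e}" "x \<noteq> y"
            using edgeE V by metis
          have "{x, y} \<in> {{z, a}, {a, b}, {b, e}, {e, d}, {d, z}} \<union> {{z, b}, {b, d}, {d, a}, {a, e}, {e, z}}"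
            using xy by (elim insertE emptyE; simp add: doubleton_eq_iff)
          then show "f \<in> cycle_edges ?C \<union> cycle_edges ?D" by (simp only: f cycle_edges_5)
        qed
      qed
      \<comment> \<open>A common edge would have both colors, but these differ.\<close>
      moreover have "cycle_edges ?C \<inter> cycle_edges ?D = {}" using mC mD eqs(9) by (metis disjoint_iff)
      moreover have "monochromatic G (cycle_edges ?C)" "monochromatic G (cycle_edges ?D)"
        using mC mD by (auto simp: monochromatic_def)
      ultimately have "two_mono_pentagons G"
        unfolding two_mono_pentagons_def using assms(2)
        by (intro conjI exI[of _ ?C] exI[of _ ?D]) simp_all
      then show ?thesis by blast
    qed
  qed
qed

end
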